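(* Let $(X,d)$ be a metric space, $\mathcal{M}$ its maximal-clique cover, $P$ a persistent clique partition of $X$, and $\mathcal{M}_P$ the pullback of the quotient maximal-clique cover. Then $\mathcal{M}$ and $\mathcal{M}_P$ are $3$-approximated up to contiguity; that is, for every $r\in\mathbb{R}_+$ there exist refinement maps $$f_r:\mathcal{M}(r)\to\mathcal{M}_P(r)\qquad\text{and}\qquad g_r:\mathcal{M}_P(r)\to\mathcal{M}(3r).$$
   Context: $\mathbb{R}_+=[0,\infty)$. A cover of a set $X$ is an indexed family $\mathcal{U}=\{U_i\}_{i\in I}$ of sets with $X=\bigcup_{i\in I}U_i$. A refinement map $\{V_j\}_{j\in J}\to\{U_i\}_{i\in I}$ is a function $f:J\to I$ with $V_j\subseteq U_{f(j)}$ for all $j$. A subset $M\subseteq X$ is an $r$-clique if $\mathrm{diam}(M)\le r$, and is maximal if not properly contained in another $r$-clique. $\mathcal{M}(r)$ is the cover of $X$ by all maximal $r$-cliques. A persistent clique partition $P$ of $X$ assigns to each $r\in\mathbb{R}_+$ a partition $P(r)$ of $X$ (into nonempty blocks) such that every block $C\in P(r)$ has $\mathrm{diam}(C)\le r$, and for $s\le t$ every block of $P(s)$ is contained in a block of $P(t)$. Let $q_r:X\to X/P(r)$ be the projection to the set of blocks. The quotient cover is $(\mathcal{M}/P)(r)=\{q_r(M)\}_{M\in\mathcal{M}(r)}$, a cover of $X/P(r)$, and its pullback is the cover of $X$ $$\mathcal{M}_P(r)=\{q_r^{-1}(q_r(M))\}_{M\in\mathcal{M}(r)}.$$ Families of covers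 $\mathcal{U}(r),\mathcal{V}(r)$ of $X$ (each increasing under refinement as $r$ grows) are $c$-approximated up to contiguity if for every $r$ there exist refinement maps $\mathcal{U}(r)\to\mathcal{V}(cr)$ and $\mathcal{V}(r)\to\mathcal{U}(cr)$. *)

theory Defs
  imports "HOL-Analysis.Analysis" "HOL-Library.Disjoint_Sets"
begin

text \<open>
  An indexed family of sets is an index set together with a map that is only relevant on that
  index set.  Repetitions among the members are allowed.
\<close>

type_synonym ('i, 'a) set_family = "'i set \<times> ('i \<Rightarrow> 'a set)"

definition is_cover :: "'a set \<Rightarrow> ('i, 'a) set_family \<Rightarrow> bool" where
  "is_cover X \<U> \<longleftrightarrow> X = (\<Union>i \<in> fst \<U>. snd \<U> i)"

definition refinement_map ::
    "('j \<Rightarrow> 'i) \<Rightarrow> ('j, 'a) set_family \<Rightarrow> ('i, 'a) set_family \<Rightarrow> bool" where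
  "refinement_map f \<V> \<U> \<longleftrightarrow>
     f \<in> fst \<V> \<rightarrow> fst \<U> \<and> (\<forall>j \<in> fst \<V>. snd \<V> j \<subseteq> snd \<U> (f j))"

definition increasing_covers :: "'a set \<Rightarrow> (real \<Rightarrow> ('i, 'a) set_family) \<Rightarrow> bool" where
  "increasing_covers X \<U> \<longleftrightarrow>
     (\<forall>r\<ge>0. is_cover X (\<U> r)) \<and>
     (\<forall>s t. 0 \<le> s \<longrightarrow> s \<le> t \<longrightarrow> (\<exists>f. refinement_map f (\<U> s) (\<U> t)))"

definition approximated_up_to_contiguity ::
    "'a set \<Rightarrow> real \<Rightarrow> (real \<Rightarrow> ('i, 'a) set_family) \<Rightarrow> (real \<Rightarrow> ('j, 'a) set_family) \<Rightarrow> bool" where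
  "approximated_up_to_contiguity X c \<U> \<V> \<longleftrightarrow>
     increasing_covers X \<U> \<and> increasing_covers X \<V> \<and>
     (\<forall>r\<ge>0. (\<exists>f. refinement_map f (\<U> r) (\<V> (c * r))) \<and>
             (\<exists>g. refinement_map g (\<V> r) (\<U> (c * r))))"

text \<open>
  The diameter lives in the extended nonnegative reals, so that it is infinite on unbounded sets
  and zero on the empty set (the real-valued \<^const>\<open>diameter\<close> is unspecified on unbounded sets).
\<close>

definition diam :: "('a \<Rightarrow> 'a \<Rightarrow> real) \<Rightarrow> 'a set \<Rightarrow> ennreal" where
  "diam d S = (SUP x\<in>S. SUP y\<in>S. ennreal (d x y))"

definition clique :: "'a set \<Rightarrow> ('a \<Rightarrow> 'a \<Rightarrow> real) \<Rightarrow> real \<Rightarrow> 'a set \<Rightarrow> bool" where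
  "clique X d r S \<longleftrightarrow> S \<subseteq> X \<and> diam d S \<le> ennreal r"

definition maximal_clique :: "'a set \<Rightarrow> ('a \<Rightarrow> 'a \<Rightarrow> real) \<Rightarrow> real \<Rightarrow> 'a set \<Rightarrow> bool" where
  "maximal_clique X d r S \<longleftrightarrow> clique X d r S \<and> \<not> (\<exists>T. clique X d r T \<and> S \<subset> T)"

text \<open>The cover by all maximal cliques is indexed by itself.\<close>

definition maximal_clique_cover ::
    "'a set \<Rightarrow> ('a \<Rightarrow> 'a \<Rightarrow> real) \<Rightarrow> real \<Rightarrow> ('a set, 'a) set_family" where
  "maximal_clique_cover X d r = ({S. maximal_clique X d r S}, \<lambda>S. S)"

definition persistent_clique_partition ::
    "'a set \<Rightarrow> ('a \<Rightarrow> 'a \<Rightarrow> real) \<Rightarrow> (real \<Rightarrow> 'a set set) \<Rightarrow> bool" where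
  "persistent_clique_partition X d P \<longleftrightarrow>
     (\<forall>r\<ge>0. partition_on X (P r) \<and> (\<forall>C \<in> P r. diam d C \<le> ennreal r)) \<and>
     (\<forall>s t. 0 \<le> s \<longrightarrow> s \<le> t \<longrightarrow> (\<forall>C \<in> P s. \<exists>D \<in> P t. C \<subseteq> D))"

definition block_of :: "'a set set \<Rightarrow> 'a \<Rightarrow> 'a set" where
  "block_of Q x = (THE C. C \<in> Q \<and> x \<in> C)"

text \<open>The set of blocks \<open>P r\<close> itself is the quotient of \<open>X\<close>, with projection \<open>block_of (P r)\<close>.\<close>

definition quotient_cover ::
    "'a set \<Rightarrow> ('a \<Rightarrow> 'a \<Rightarrow> real) \<Rightarrow> (real \<Rightarrow> 'a set set) \<Rightarrow> real \<Rightarrow> ('a set, 'a set) set_family" where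
  "quotient_cover X d P r =
     (fst (maximal_clique_cover X d r),
      \<lambda>S. block_of (P r) ` snd (maximal_clique_cover X d r) S)"

definition pullback_family ::
    "'a set \<Rightarrow> ('a \<Rightarrow> 'b) \<Rightarrow> ('i, 'b) set_family \<Rightarrow> ('i, 'a) set_family" where
  "pullback_family X q \<U> = (fst \<U>, \<lambda>i. {x \<in> X. q x \<in> snd \<U> i})"

definition pullback_quotient_cover ::
    "'a set \<Rightarrow> ('a \<Rightarrow> 'a \<Rightarrow> real) \<Rightarrow> (real \<Rightarrow> 'a set set) \<Rightarrow> real \<Rightarrow> ('a set, 'a) set_family" where
  "pullback_quotient_cover X d P r =
     pullback_family X (block_of (P r)) (quotient_cover X d P r)"

end

theory Submission
  imports Defs
begin

text \<open>
  Refinement maps exist as soon as every member of one family lies in some member of the other, and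
  by Zorn's lemma every \<open>r\<close>-clique lies in a maximal one.  So it suffices to show that the saturation
  of an \<open>r\<close>-clique by the blocks of \<open>P r\<close> is a \<open>3r\<close>-clique: two of its points are joined by a chain
  of three steps of length at most \<open>r\<close>, namely inside a block, inside the clique, and inside a block.
\<close>

text \<open>The axiom of choice assembles the containing members into one map, so every refinement
  below reduces to containments and no map is ever built by hand.\<close>

lemma refinement_map_exists_iff:
  "(\<exists>f. refinement_map f \<V> \<U>) \<longleftrightarrow> (\<forall>j \<in> fst \<V>. \<exists>i \<in> fst \<U>. snd \<V> j \<subseteq> snd \<U> i)"
proof
  assume "\<exists>f. refinement_map f \<V> \<U>"
  then show "\<forall>j \<in> fst \<V>. \<exists>i \<in> fst \<U>. snd \<V> j \<subseteq> snd \<U> i"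
    unfolding refinement_map_def by blast
next
  assume "\<forall>j \<in> fst \<V>. \<exists>i \<in> fst \<U>. snd \<V> j \<subseteq> snd \<U> i"
  then obtain f where "\<forall>j \<in> fst \<V>. f j \<in> fst \<U> \<and> snd \<V> j \<subseteq> snd \<U> (f j)"
    by (metis bchoice)
  then show "\<exists>f. refinement_map f \<V> \<U>"
    unfolding refinement_map_def by blast
qed

text \<open>Brings diameters from \<open>ennreal\<close> back to real distances. The sign of
  \<open>r\<close> matters because \<open>ennreal\<close> sends every negative real to 0.\<close>

lemma diam_le_iff:
  assumes "0 \<le> r"
  shows "diam d S \<le> ennreal r \<longleftrightarrow> (\<forall>x\<in>S. \<forall>y\<in>S. d x y \<le> r)"
  using assms by (simp add: diam_def SUP_le_iff ennreal_le_iff)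

lemma clique_iff:
  assumes "0 \<le> r"
  shows "clique X d r S \<longleftrightarrow> S \<subseteq> X \<and> (\<forall>x\<in>S. \<forall>y\<in>S. d x y \<le> r)"
  using assms by (simp add: clique_def diam_le_iff)

lemma clique_mono: "clique X d s S \<Longrightarrow> s \<le> t \<Longrightarrow> clique X d t S"
  unfolding clique_def using ennreal_leI order_trans by blast

lemma clique_subset_maximal_clique:
  assumes r: "0 \<le> r" and S: "clique X d r S"
  obtains M where "maximal_clique X d r M" "S \<subseteq> M"
proof -
  \<comment> \<open>Restricting Zorn's lemma to the cliques above \<open>S\<close> makes the maximal
    element contain \<open>S\<close>.\<close>
  let ?A = "{T. clique X d r T \<and> S \<subseteq> T}"
  have "\<exists>M\<in>?A. \<forall>T\<in>?A. M \<subseteq> T \<longrightarrow> T = M"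
  proof (rule subset_Zorn_nonempty)
    show "?A \<noteq> {}" using S by blast
  next
    fix \<C> assume ne: "\<C> \<noteq> {}" and ch: "subset.chain ?A \<C>"
    have mem: "clique X d r T" "S \<subseteq> T" if "T \<in> \<C>" for T
      using that ch unfolding subset_chain_def by blast+
    have "d x y \<le> r" if "x \<in> \<Union>\<C>" "y \<in> \<Union>\<C>" for x y
    proof -
      \<comment> \<open>Of two chain members, one containing \<open>x\<close> and one containing
        \<open>y\<close>, the larger contains both points.\<close>
      obtain T where "T \<in> \<C>" "x \<in> T" "y \<in> T"
        using \<open>x \<in> \<Union>\<C>\<close> \<open>y \<in> \<Union>\<C>\<close> ch unfolding subset_chain_def by blast
      then show ?thesis
        using mem(1) r by (auto simp: clique_iff)
    qed
    moreover have "\<Union>\<C> \<subseteq> X"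
      using mem(1) unfolding clique_def by blast
    moreover have "S \<subseteq> \<Union>\<C>"
      using ne mem(2) by blast
    ultimately show "\<Union>\<C> \<in> ?A"
      using r by (simp add: clique_iff)
  qed
  then obtain M where M: "clique X d r M" "S \<subseteq> M"
    and max: "\<And>T. clique X d r T \<Longrightarrow> S \<subseteq> T \<Longrightarrow> M \<subseteq> T \<Longrightarrow> T = M"
    by auto
  \<comment> \<open>Maximality within \<open>?A\<close> is maximality among all cliques: anything
    above \<open>M\<close> also contains \<open>S\<close>.\<close>
  have "\<not> M \<subset> T" if "clique X d r T" for T
    using max[OF that] M(2) by blast
  then show thesis
    using M that[of M] by (simp add: maximal_clique_def)
qed

text \<open>Eliminates the description operator: covering gives a block through each point of
  \<open>X\<close>, and disjointness makes it unique. Later arguments speak only of common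
  blocks.\<close>

lemma block_of_eq_iff:
  assumes Q: "partition_on X Q" and x: "x \<in> X" and y: "y \<in> X"
  shows "block_of Q x = block_of Q y \<longleftrightarrow> (\<exists>C\<in>Q. x \<in> C \<and> y \<in> C)"
proof -
  have block: "block_of Q z = C" if "C \<in> Q" "z \<in> C" for z C
    unfolding block_of_def using partition_onD2[OF Q] that
    by (intro the_equality) (auto dest: disjointD)
  obtain C D where "C \<in> Q" "x \<in> C" "D \<in> Q" "y \<in> D"
    using partition_onD1[OF Q] x y by blast
  with block show ?thesis by metis
qed

text \<open>This is the preimage under \<open>q\<close> of the image of \<open>S\<close>; for
  \<open>q = block_of (P r)\<close> it is the member of the pullback cover indexed by
  \<open>S\<close>.\<close>

definition saturation :: "'a set \<Rightarrow> ('a \<Rightarrow> 'b) \<Rightarrow> 'a set \<Rightarrow> 'a set" where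
  "saturation X q S = {x \<in> X. q x \<in> q ` S}"

lemma subset_saturation: "S \<subseteq> X \<Longrightarrow> S \<subseteq> saturation X q S"
  by (auto simp: saturation_def)

lemma saturation_mono: "S \<subseteq> T \<Longrightarrow> saturation X q S \<subseteq> saturation X q T"
  by (auto simp: saturation_def)

lemma fst_maximal_clique_cover [simp]:
  "fst (maximal_clique_cover X d r) = {S. maximal_clique X d r S}"
  by (simp add: maximal_clique_cover_def)

lemma snd_maximal_clique_cover [simp]: "snd (maximal_clique_cover X d r) S = S"
  by (simp add: maximal_clique_cover_def)

lemma fst_pullback_quotient_cover [simp]:
  "fst (pullback_quotient_cover X d P r) = {S. maximal_clique X d r S}"
  by (simp add: pullback_quotient_cover_def pullback_family_def quotient_cover_def)

lemma snd_pullback_quotient_cover [simp]: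
  "snd (pullback_quotient_cover X d P r) S = saturation X (block_of (P r)) S"
  by (simp add: pullback_quotient_cover_def pullback_family_def quotient_cover_def saturation_def)

lemma maximal_clique_subset: "maximal_clique X d r S \<Longrightarrow> S \<subseteq> X"
  by (simp add: maximal_clique_def clique_def)

text \<open>Blocks only merge as the scale grows, so two points sharing a block of
  \<open>P s\<close> share one of \<open>P t\<close>.\<close>

lemma saturation_mono_scale:
  assumes P: "persistent_clique_partition X d P" and st: "0 \<le> s" "s \<le> t" and S: "S \<subseteq> X"
  shows "saturation X (block_of (P s)) S \<subseteq> saturation X (block_of (P t)) S"
proof
  fix x assume "x \<in> saturation X (block_of (P s)) S"
  then obtain y where xy: "x \<in> X" "y \<in> S" "block_of (P s) x = block_of (P s) y"
    by (auto simp: saturation_def)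
  have parts: "partition_on X (P s)" "partition_on X (P t)"
    using P st by (simp_all add: persistent_clique_partition_def)
  have y: "y \<in> X" using xy S by blast
  obtain C where C: "C \<in> P s" "x \<in> C" "y \<in> C"
    using xy y block_of_eq_iff[OF parts(1)] by blast
  obtain D where "D \<in> P t" "C \<subseteq> D"
    using P st C(1) unfolding persistent_clique_partition_def by blast
  then have "block_of (P t) x = block_of (P t) y"
    using C xy(1) y block_of_eq_iff[OF parts(2)] by blast
  then show "x \<in> saturation X (block_of (P t)) S"
    using xy by (auto simp: saturation_def)
qed

text \<open>The factor 3 arises here, from two applications of the triangle inequality.\<close>

lemma clique_saturation:
  assumes X: "Metric_space X d" and P: "persistent_clique_partition X d P"
    and r: "0 \<le> r" and S: "clique X d r S"
  shows "clique X d (3 * r) (saturation X (block_of (P r)) S)"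
proof -
  interpret Metric_space X d by (fact X)
  have part: "partition_on X (P r)"
    using P r by (simp add: persistent_clique_partition_def)
  have SX: "S \<subseteq> X" and Sr: "\<And>u v. u \<in> S \<Longrightarrow> v \<in> S \<Longrightarrow> d u v \<le> r"
    using S r by (auto simp: clique_iff)
  \<comment> \<open>A saturated point shares a block with some point of \<open>S\<close>, and blocks
    of \<open>P r\<close> have diameter at most \<open>r\<close>.\<close>
  have near: "\<exists>u\<in>S. x \<in> X \<and> d x u \<le> r" if x: "x \<in> saturation X (block_of (P r)) S" for x
  proof -
    obtain u where u: "x \<in> X" "u \<in> S" "block_of (P r) x = block_of (P r) u"
      using x by (auto simp: saturation_def)
    then obtain C where "C \<in> P r" "x \<in> C" "u \<in> C"
      using block_of_eq_iff[OF part] SX by blast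
    then have "d x u \<le> r"
      using P r unfolding persistent_clique_partition_def by (metis diam_le_iff)
    with u show ?thesis by blast
  qed
  have "d x y \<le> 3 * r"
    if xy: "x \<in> saturation X (block_of (P r)) S" "y \<in> saturation X (block_of (P r)) S" for x y
  proof -
    obtain u v where u: "u \<in> S" "x \<in> X" "d x u \<le> r" and v: "v \<in> S" "y \<in> X" "d y v \<le> r"
      using near xy by meson
    have "d x y \<le> d x u + d u y" "d u y \<le> d u v + d v y"
      using u v SX by (auto intro: triangle)
    then show ?thesis
      using u v Sr[of u v] commute[of v y] by linarith
  qed
  then show ?thesis
    using r by (auto simp: clique_iff saturation_def)
qed

lemma increasing_maximal_clique_cover:
  assumes X: "Metric_space X d"
  shows "increasing_covers X (maximal_clique_cover X d)"
  unfolding increasing_covers_def refinement_map_exists_iff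
proof (intro conjI allI impI)
  fix r :: real assume r: "0 \<le> r"
  have "\<exists>M. maximal_clique X d r M \<and> x \<in> M" if "x \<in> X" for x
  proof -
    \<comment> \<open>Since \<open>d x x = 0\<close>, a singleton is a clique at every scale,
      including \<open>r = 0\<close>, and extends to a maximal one.\<close>
    have "clique X d r {x}"
      using that r Metric_space.mdist_zero[OF X that] by (simp add: clique_iff)
    then show ?thesis using clique_subset_maximal_clique[OF r] by blast
  qed
  then show "is_cover X (maximal_clique_cover X d r)"
    by (auto simp: is_cover_def dest: maximal_clique_subset)
next
  fix s t :: real assume st: "0 \<le> s" "s \<le> t"
  have "\<exists>T. maximal_clique X d t T \<and> S \<subseteq> T" if S: "maximal_clique X d s S" for S
  proof -
    have "0 \<le> t" "clique X d t S"
      using S st by (auto simp: maximal_clique_def intro: clique_mono)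
    then show ?thesis by (rule clique_subset_maximal_clique) blast
  qed
  then show "\<forall>j\<in>fst (maximal_clique_cover X d s). \<exists>i\<in>fst (maximal_clique_cover X d t).
      snd (maximal_clique_cover X d s) j \<subseteq> snd (maximal_clique_cover X d t) i"
    by simp
qed

text \<open>Enlarge a clique to a maximal one at scale \<open>t\<close>, which lies in its own
  saturation. Two scales are allowed because the final theorem compares \<open>r\<close> both with
  \<open>r\<close> and with \<open>3 * r\<close>.\<close>

lemma maximal_clique_cover_refines_pullback:
  assumes X: "Metric_space X d" and st: "0 \<le> s" "s \<le> t"
  shows "\<exists>f. refinement_map f (maximal_clique_cover X d s) (pullback_quotient_cover X d P t)"
proof -
  have "\<exists>T. maximal_clique X d t T \<and> S \<subseteq> saturation X (block_of (P t)) T"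
    if S: "maximal_clique X d s S" for S
  proof -
    have "\<exists>f. refinement_map f (maximal_clique_cover X d s) (maximal_clique_cover X d t)"
      using increasing_maximal_clique_cover[OF X] st unfolding increasing_covers_def by blast
    then obtain T where T: "maximal_clique X d t T" "S \<subseteq> T"
      using S by (auto simp: refinement_map_exists_iff)
    have "T \<subseteq> saturation X (block_of (P t)) T"
      using T(1) by (intro subset_saturation maximal_clique_subset)
    with T show ?thesis by blast
  qed
  then show ?thesis
    by (simp add: refinement_map_exists_iff)
qed

text \<open>The covering property passes from the maximal cliques to their saturations, which are
  larger but stay inside \<open>X\<close>. For monotonicity the scale and the clique are enlarged
  separately.\<close>

lemma increasing_pullback_quotient_cover:
  assumes X: "Metric_space X d" and P: "persistent_clique_partition X d P"
  shows "increasing_covers X (pullback_quotient_cover X d P)"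
proof -
  note inc = increasing_maximal_clique_cover[OF X]
  have "is_cover X (pullback_quotient_cover X d P r)" if "0 \<le> r" for r
  proof -
    have "X = \<Union>{S. maximal_clique X d r S}"
    proof -
      have "is_cover X (maximal_clique_cover X d r)"
        using inc that unfolding increasing_covers_def by blast
      then show ?thesis
        unfolding is_cover_def fst_maximal_clique_cover snd_maximal_clique_cover by simp
    qed
    moreover have "S \<subseteq> saturation X (block_of (P r)) S" if "maximal_clique X d r S" for S
      using that by (intro subset_saturation maximal_clique_subset)
    moreover have "saturation X (block_of (P r)) S \<subseteq> X" for S
      by (auto simp: saturation_def)
    ultimately show ?thesis
      unfolding is_cover_def fst_pullback_quotient_cover snd_pullback_quotient_cover by blast
  qed
  moreover have "\<exists>f. refinement_map f (pullback_quotient_cover X d P s) (pullback_quotient_cover X d P t)"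
    if st: "0 \<le> s" "s \<le> t" for s t
  proof -
    have "\<exists>T. maximal_clique X d t T \<and>
        saturation X (block_of (P s)) S \<subseteq> saturation X (block_of (P t)) T"
      if S: "maximal_clique X d s S" for S
    proof -
      have "\<exists>f. refinement_map f (maximal_clique_cover X d s) (maximal_clique_cover X d t)"
        using inc st unfolding increasing_covers_def by blast
      then obtain T where T: "maximal_clique X d t T" "S \<subseteq> T"
        using S by (auto simp: refinement_map_exists_iff)
      \<comment> \<open>First the partition coarsens with \<open>S\<close> fixed, then
        \<open>S\<close> grows to \<open>T\<close> with the partition fixed.\<close>
      have "saturation X (block_of (P s)) S \<subseteq> saturation X (block_of (P t)) S"
        using S by (intro saturation_mono_scale[OF P st] maximal_clique_subset)
      also have "\<dots> \<subseteq> saturation X (block_of (P t)) T"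
        using T(2) by (rule saturation_mono)
      finally show ?thesis using T(1) by blast
    qed
    then show ?thesis
      by (simp add: refinement_map_exists_iff)
  qed
  ultimately show ?thesis
    unfolding increasing_covers_def by blast
qed

text \<open>The saturation is a clique at scale \<open>3 * r\<close>, though possibly not a maximal
  one, so Zorn's lemma is applied once more at that scale.\<close>

lemma pullback_refines_maximal_clique_cover:
  assumes X: "Metric_space X d" and P: "persistent_clique_partition X d P" and r: "0 \<le> r"
  shows "\<exists>g. refinement_map g (pullback_quotient_cover X d P r) (maximal_clique_cover X d (3 * r))"
proof -
  have "\<exists>T. maximal_clique X d (3 * r) T \<and> saturation X (block_of (P r)) S \<subseteq> T"
    if S: "maximal_clique X d r S" for S
  proof -
    have "0 \<le> 3 * r" "clique X d (3 * r) (saturation X (block_of (P r)) S)"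
      using S r clique_saturation[OF X P r] by (simp_all add: maximal_clique_def)
    then show ?thesis by (rule clique_subset_maximal_clique) blast
  qed
  then show ?thesis
    by (simp add: refinement_map_exists_iff)
qed

theorem theorem4p14:
  fixes X :: "'a set" and d :: "'a \<Rightarrow> 'a \<Rightarrow> real" and P :: "real \<Rightarrow> 'a set set"
  assumes "Metric_space X d"
    and "persistent_clique_partition X d P"
  shows "approximated_up_to_contiguity X 3
           (maximal_clique_cover X d) (pullback_quotient_cover X d P) \<and>
         (\<forall>r\<ge>0.
           (\<exists>f. refinement_map f (maximal_clique_cover X d r) (pullback_quotient_cover X d P r)) \<and>
           (\<exists>g. refinement_map g (pullback_quotient_cover X d P r)
                                 (maximal_clique_cover X d (3 * r))))"
proof -
  \<comment> \<open>Serves the forward refinement from \<open>r\<close> to \<open>3 * r\<close>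
    required by the approximation; the sharper one at the same scale uses \<open>order_refl\<close>
    instead.\<close>
  have r: "r \<le> 3 * r" if "0 \<le> r" for r :: real
    using that by simp
  show ?thesis
    unfolding approximated_up_to_contiguity_def
    by (intro conjI allI impI increasing_maximal_clique_cover increasing_pullback_quotient_cover
        maximal_clique_cover_refines_pullback pullback_refines_maximal_clique_cover assms r order_refl)
qed

end
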